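(* Let $k\in\mathbb{N}$ with $k\geq 2$ and let $Z\subseteq(0,1)$ be such that either $Z$ is nonmeagre with the property of Baire, or $Z$ is Lebesgue measurable with $\lambda(Z)>0$. Then there exists $H\subseteq\mathbb{R}$ such that $|H|=\mathfrak{c}$ and $kH\subseteq Z$.
   Context: $\lambda$ is Lebesgue measure, $\mathfrak{c}=|\mathbb{R}|$, and $kH=\{h_1+\cdots+h_k:h_i\in H\}$ (repetitions allowed). *)

theory Defs
  imports "HOL-Analysis.Analysis"
begin

definition nowhere_dense :: "'a::topological_space set \<Rightarrow> bool" where
  "nowhere_dense A \<longleftrightarrow> interior (closure A) = {}"

definition meagre :: "'a::topological_space set \<Rightarrow> bool" where
  "meagre A \<longleftrightarrow> (\<exists>\<N>. countable \<N> \<and> (\<forall>N\<in>\<N>. nowhere_dense N) \<and> A = \<Union>\<N>)"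

definition has_baire_property :: "'a::topological_space set \<Rightarrow> bool" where
  "has_baire_property A \<longleftrightarrow> (\<exists>U. open U \<and> meagre ((A - U) \<union> (U - A)))"

(* The k-fold sumset kH (not the dilate of H by k): the k summands need not be distinct. *)
definition ksumset :: "nat \<Rightarrow> 'a::comm_monoid_add set \<Rightarrow> 'a set" where
  "ksumset k H = {\<Sum>i<k. h i |h. \<forall>i<k. h i \<in> H}"

end

theory Submission
  imports Defs
begin

text \<open>
  The set \<open>H\<close> is \<open>{z/k + (\<Sum>i\<in>A. b\<^sub>i) | A \<subseteq> \<nat>}\<close> for a rapidly decreasing positive
  sequence \<open>b\<close>, so that every element of \<open>kH\<close> has the form \<open>z + (\<Sum>i. c\<^sub>i b\<^sub>i)\<close> with
  \<open>c\<^sub>i \<in> {0..k}\<close>. One chooses \<open>b\<^sub>i\<close> together with nonempty compact sets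
  \<open>K\<^sub>0 \<supseteq> K\<^sub>1 \<supseteq> \<dots>\<close> such that \<open>K\<^sub>i\<^sub>+\<^sub>1 + c b\<^sub>i \<subseteq> K\<^sub>i\<close> for all \<open>c \<le> k\<close>, and takes \<open>z\<close> in their
  intersection; then \<open>z\<close> plus the tail of the series from \<open>n\<close> on lies in \<open>K\<^sub>n\<close>. In the measure case
  the \<open>K\<^sub>i\<close> have positive measure, which small translations respect by regularity. In the category
  case they are intervals whose translates by the finitely many \<open>n\<close>-th partial sums avoid
  the \<open>n\<close>-th nowhere dense set.
\<close>

section \<open>Rapidly decreasing sequences and the construction scheme\<close>

text \<open>Comparison with a geometric series of ratio 1/3 bounds the tail after \<open>n\<close>
  by \<open>3/2 * b (Suc n)\<close>, which is below \<open>b n\<close>. So the first index where two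
  sets differ decides which sum is larger. Injectivity later provides continuum many points of
  \<open>H\<close>.\<close>

lemma suminf_indicator_inj:
  fixes b :: "nat \<Rightarrow> real"
  assumes pos: "\<And>n. 0 < b n" and dec: "\<And>n. b (Suc n) < b n / 3"
  shows "summable b" and "inj (\<lambda>A. \<Sum>i. of_bool (i \<in> A) * b i)"
proof -
  have geo: "b (i + n) \<le> b n * (1/3) ^ i" for i n
  proof (induction i)
    case (Suc i)
    then show ?case using dec[of "i + n"] by simp
  qed simp
  have sgeo: "summable (\<lambda>i. b n * (1/3) ^ i)" for n
    by (intro summable_mult summable_geometric) simp
  show sb: "summable b"
    by (rule summable_comparison_test[OF _ sgeo[of 0]]) (use geo[of _ 0] pos in \<open>auto simp: less_imp_le\<close>)
  have sA: "summable (\<lambda>i. of_bool (i \<in> A) * b i)" for A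
    by (rule summable_comparison_test[OF _ sb]) (use pos in \<open>auto simp: less_imp_le\<close>)
  have tail: "(\<Sum>i. b (i + Suc n)) < b n" for n
  proof -
    have "(\<Sum>i. b (i + Suc n)) \<le> (\<Sum>i. b (Suc n) * (1/3) ^ i)"
      using geo[of _ "Suc n"] by (intro suminf_le sgeo summable_ignore_initial_segment sb)
    also have "\<dots> = b (Suc n) * (3/2)"
      by (simp add: suminf_mult summable_geometric suminf_geometric)
    also have "\<dots> < b n" using dec[of n] pos[of n] by simp
    finally show ?thesis .
  qed
  \<comment> \<open>Lexicographic comparison: even if \<open>B\<close> contained every index after
    \<open>n\<close>, its gain there would not make up for the missing \<open>b n\<close>.\<close>
  have less: "(\<Sum>i. of_bool (i \<in> B) * b i) < (\<Sum>i. of_bool (i \<in> A) * b i)"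
    if n: "n \<in> A" "n \<notin> B" and eq: "\<And>i. i < n \<Longrightarrow> i \<in> A \<longleftrightarrow> i \<in> B" for A B n
  proof -
    have "(\<Sum>i. of_bool (i \<in> B) * b i)
        = (\<Sum>i. of_bool (i + Suc n \<in> B) * b (i + Suc n)) + (\<Sum>i<Suc n. of_bool (i \<in> B) * b i)"
      by (rule suminf_split_initial_segment[OF sA])
    also have "\<dots> \<le> (\<Sum>i. b (i + Suc n)) + (\<Sum>i<Suc n. of_bool (i \<in> B) * b i)"
      using pos
      by (intro add_right_mono suminf_le summable_ignore_initial_segment sb
          summable_ignore_initial_segment[OF sA]) (auto simp: less_imp_le)
    also have "\<dots> < b n + (\<Sum>i<Suc n. of_bool (i \<in> B) * b i)" using tail by simp
    also have "\<dots> = (\<Sum>i<Suc n. of_bool (i \<in> A) * b i)" using n eq by simp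
    also have "\<dots> \<le> (\<Sum>i. of_bool (i \<in> A) * b i)"
      using pos by (intro sum_le_suminf sA) (auto simp: less_imp_le)
    finally show ?thesis .
  qed
  show "inj (\<lambda>A. \<Sum>i. of_bool (i \<in> A) * b i)"
  proof (rule injI, rule ccontr)
    fix A B :: "nat set"
    assume eq: "(\<Sum>i. of_bool (i \<in> A) * b i) = (\<Sum>i. of_bool (i \<in> B) * b i)" and "A \<noteq> B"
    then obtain m where "(m \<in> A) \<noteq> (m \<in> B)" by blast
    then obtain n where n: "(n \<in> A) \<noteq> (n \<in> B)" "\<And>i. i < n \<Longrightarrow> (i \<in> A) = (i \<in> B)"
      using exists_least_iff[of "\<lambda>i. (i \<in> A) \<noteq> (i \<in> B)"] by blast
    then show False
      using less[of n A B] less[of n B A] eq by auto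
  qed
qed

text \<open>In \<open>P n K S\<close>, the set \<open>S\<close> collects the partial sums \<open>\<Sum>i<n. c\<^sub>i b\<^sub>i\<close> with \<open>c\<^sub>i \<le> k\<close>.\<close>

lemma continuum_sumset_scheme:
  fixes P :: "nat \<Rightarrow> real set \<Rightarrow> real set \<Rightarrow> bool" and k :: nat
  assumes "0 < k"
    and init: "P 0 K0 {0}"
    and comp: "\<And>n K S. P n K S \<Longrightarrow> compact K \<and> K \<noteq> {}"
    and step: "\<And>n K S e. P n K S \<Longrightarrow> 0 < e \<Longrightarrow>
      \<exists>a K'. 0 < a \<and> a < e \<and> (\<forall>m\<le>k. \<forall>x\<in>K'. x + real m * a \<in> K) \<and>
        P (Suc n) K' ((\<lambda>(s, m). s + real m * a) ` (S \<times> {..k}))"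
  shows "\<exists>H :: real set. H \<approx> (UNIV :: real set) \<and>
    (\<forall>y\<in>ksumset k H. \<forall>n. \<exists>K S. P n K S \<and> (\<exists>s\<in>S. \<exists>x\<in>K. y = s + x))"
proof -
  \<comment> \<open>Dependent choice runs on triples whose third entry is the increment chosen last.
    The clause for \<open>n = 0\<close> records the initial \<open>S\<close>, about which the chosen
    sequence would otherwise say nothing.\<close>
  define R where "R n w \<longleftrightarrow> (case w of (K, S, a) \<Rightarrow> P n K S \<and> (0::real) < a \<and> (n = 0 \<longrightarrow> S = {0}))"
    for n w
  define Q where "Q w w' \<longleftrightarrow> (case (w, w') of ((K, S, a), (K', S', a')) \<Rightarrow>
      a' < a / 3 \<and> S' = (\<lambda>(s, m). s + real m * a') ` (S \<times> {..k}) \<and>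
      (\<forall>m\<le>k. \<forall>x\<in>K'. x + real m * a' \<in> K))" for w w' :: "real set \<times> real set \<times> real"
  have "\<exists>f. \<forall>n. R n (f n) \<and> Q (f n) (f (Suc n))"
  proof (rule dependent_nat_choice)
    show "\<exists>w. R 0 w" using init unfolding R_def by (intro exI[of _ "(K0, {0}, 1)"]) simp
    fix w n assume "R n w"
    then obtain K S a where w: "w = (K, S, a)" and "P n K S" "0 < a" by (auto simp: R_def)
    then obtain a' K' where "0 < a'" "a' < a / 3" "\<forall>m\<le>k. \<forall>x\<in>K'. x + real m * a' \<in> K"
      "P (Suc n) K' ((\<lambda>(s, m). s + real m * a') ` (S \<times> {..k}))"
      using step[of n K S "a / 3"] by auto
    then show "\<exists>w'. R (Suc n) w' \<and> Q w w'"
      unfolding w R_def Q_def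
      by (intro exI[of _ "(K', (\<lambda>(s, m). s + real m * a') ` (S \<times> {..k}), a')"]) simp
  qed
  then obtain f where f: "\<And>n. R n (f n)" "\<And>n. Q (f n) (f (Suc n))" by blast
  define K where "K n = fst (f n)" for n
  define S where "S n = fst (snd (f n))" for n
  \<comment> \<open>The shift makes \<open>b n\<close> the increment from stage \<open>n\<close> to
    stage \<open>Suc n\<close>; the entry at stage 0 is a placeholder that only bounds
    \<open>b 0\<close>.\<close>
  define b where "b n = snd (snd (f (Suc n)))" for n
  have fn: "f n = (K n, S n, snd (snd (f n)))" for n by (simp add: K_def S_def)
  have P: "P n (K n) (S n)" for n using f(1)[of n] by (subst (asm) fn) (simp add: R_def)
  have bpos: "0 < b n" for n
    using f(1)[of "Suc n"] by (subst (asm) fn) (simp add: R_def b_def)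
  have bdec: "b (Suc n) < b n / 3" for n
    using f(2)[of "Suc n"] unfolding Q_def b_def by (auto split: prod.splits)
  have SS: "S (Suc n) = (\<lambda>(s, m). s + real m * b n) ` (S n \<times> {..k})" for n
    using f(2)[of n] unfolding Q_def b_def S_def by (auto split: prod.splits)
  have KK: "x + real m * b n \<in> K n" if "m \<le> k" "x \<in> K (Suc n)" for m n x
    using f(2)[of n] that unfolding Q_def b_def K_def by (auto split: prod.splits)
  note summ = suminf_indicator_inj(1)[of b, OF bpos bdec]
    and inj = suminf_indicator_inj(2)[of b, OF bpos bdec]
  have "K (Suc n) \<subseteq> K n" for n using KK[of 0] by auto
  then have "K n \<subseteq> K m" if "m \<le> n" for m n using that by (metis lift_Suc_antimono_le)
  then have "\<Inter> (range K) \<noteq> {}" by (intro compact_nest) (use comp[OF P] in auto)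
  then obtain z where z: "\<And>n. z \<in> K n" by blast
  have S0: "S 0 = {0}" using f(1)[of 0] by (subst (asm) fn) (simp add: R_def)
  have part: "(\<Sum>i<n. real (c i) * b i) \<in> S n" if "\<And>i. c i \<le> k" for c n
  proof (induction n)
    case (Suc n)
    then show ?case using that[of n] unfolding SS by force
  qed (simp add: S0)
  \<comment> \<open>The summands are absorbed from the last one backwards, each moving the point
    from one compact set to the preceding larger one.\<close>
  have tail: "x + (\<Sum>i<j. real (c i) * b (i + n)) \<in> K n"
    if "x \<in> K (j + n)" "\<And>i. c i \<le> k" for c n j x
    using that(1)
  proof (induction j arbitrary: x)
    case (Suc j)
    then have "x + real (c j) * b (j + n) \<in> K (j + n)" using KK that(2) by simp
    from Suc.IH[OF this] show ?case by (simp add: ac_simps)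
  qed simp
  have csum: "summable (\<lambda>i. real (c i) * b i)" if "\<And>i. c i \<le> k" for c
    by (rule summable_comparison_test[OF _ summable_mult[OF summ, of k]])
      (use that bpos in \<open>auto intro!: mult_right_mono simp: less_imp_le abs_mult\<close>)
  \<comment> \<open>Split the series at \<open>n\<close>. The initial part is in \<open>S n\<close>;
    \<open>z\<close> plus the rest is a limit of points of \<open>K n\<close>, which is
    closed.\<close>
  have main: "\<exists>s\<in>S n. \<exists>x\<in>K n. z + (\<Sum>i. real (c i) * b i) = s + x"
    if c: "\<And>i. c i \<le> k" for c n
  proof (intro bexI)
    have "(\<lambda>j. \<Sum>i<j. real (c (i + n)) * b (i + n)) \<longlonglongrightarrow> (\<Sum>i. real (c (i + n)) * b (i + n))"
      by (intro summable_LIMSEQ summable_ignore_initial_segment[OF csum[OF c]])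
    then have "(\<lambda>j. z + (\<Sum>i<j. real (c (i + n)) * b (i + n)))
        \<longlonglongrightarrow> z + (\<Sum>i. real (c (i + n)) * b (i + n))"
      by (intro tendsto_intros)
    moreover have "closed (K n)" using P comp compact_imp_closed by blast
    ultimately show "z + (\<Sum>i. real (c (i + n)) * b (i + n)) \<in> K n"
      using tail[OF z, where c = "\<lambda>i. c (i + n)"] c by (rule_tac closed_sequentially) auto
    show "(\<Sum>i<n. real (c i) * b i) \<in> S n" by (rule part[OF c])
    show "z + (\<Sum>i. real (c i) * b i)
        = (\<Sum>i<n. real (c i) * b i) + (z + (\<Sum>i. real (c (i + n)) * b (i + n)))"
      using suminf_split_initial_segment[OF csum[of c], of n] c by simp
  qed
  \<comment> \<open>The share \<open>z / k\<close> makes the constants of \<open>k\<close> summands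
    add up to exactly \<open>z\<close>.\<close>
  define g where "g A = z / k + (\<Sum>i. of_bool (i \<in> A) * b i)" for A
  have "inj g" using inj unfolding g_def inj_def by simp
  then have "range g \<approx> (UNIV :: nat set set)"
    using inj_on_image_eqpoll_self by blast
  then have card: "range g \<approx> (UNIV :: real set)"
    using nat_sets_eqpoll_reals eqpoll_trans by blast
  have "\<exists>c. (\<forall>i. c i \<le> k) \<and> y = z + (\<Sum>i. real (c i) * b i)" if "y \<in> ksumset k (range g)" for y
  proof -
    obtain h where h: "y = (\<Sum>j<k. h j)" "\<forall>j<k. h j \<in> range g"
      using \<open>y \<in> ksumset k (range g)\<close> unfolding ksumset_def by blast
    then have "\<forall>j. \<exists>A. j < k \<longrightarrow> h j = g A" by blast
    then obtain A where A: "\<And>j. j < k \<Longrightarrow> h j = g (A j)" by metis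
    have sA: "summable (\<lambda>i. of_bool (i \<in> B) * b i)" for B
      using csum[of "\<lambda>i. of_bool (i \<in> B)"] \<open>0 < k\<close> by simp
    \<comment> \<open>\<open>c i\<close> counts the sets \<open>A j\<close> that contain
      \<open>i\<close>, hence is at most \<open>k\<close>.\<close>
    define c where "c i = (\<Sum>j<k. of_bool (i \<in> A j) :: nat)" for i
    have "y = (\<Sum>j<k. g (A j))" using h(1) A by simp
    also have "\<dots> = z + (\<Sum>j<k. \<Sum>i. of_bool (i \<in> A j) * b i)"
      using \<open>0 < k\<close> by (simp add: g_def sum.distrib)
    also have "(\<Sum>j<k. \<Sum>i. of_bool (i \<in> A j) * b i) = (\<Sum>i. \<Sum>j<k. of_bool (i \<in> A j) * b i)"
      by (intro suminf_sum[symmetric] sA)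
    also have "\<dots> = (\<Sum>i. real (c i) * b i)"
      by (simp only: c_def of_nat_sum of_nat_of_bool sum_distrib_right)
    finally have "y = z + (\<Sum>i. real (c i) * b i)" .
    moreover have "c i \<le> k" for i
      using sum_bounded_above[of "{..<k}" "\<lambda>j. of_bool (i \<in> A j)" "1::nat"] by (simp add: c_def)
    ultimately show ?thesis by blast
  qed
  with main P card show ?thesis by (intro exI[of _ "range g"]) blast
qed

section \<open>Tools from category and measure\<close>

text \<open>The points of \<open>S\<close> are treated one at a time: some open subinterval of the
  translate by \<open>s\<close> misses \<open>closure N\<close>, and the remaining translates are
  handled inside it. Strict inequalities at both ends keep the closed interval within that open
  one.\<close>

lemma interval_translates_avoid_nowhere_dense:
  fixes c d :: real
  assumes "finite S" "nowhere_dense N" "c < d"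
  shows "\<exists>c' d'. c < c' \<and> c' < d' \<and> d' < d \<and> (\<forall>s\<in>S. \<forall>x\<in>{c'..d'}. s + x \<notin> N)"
  using assms(1,3)
proof (induction S arbitrary: c d)
  case empty
  then show ?case by (intro exI[of _ "(2*c+d)/3"] exI[of _ "(c+2*d)/3"]) auto
next
  case (insert s S)
  have "\<not> {s + c<..<s + d} \<subseteq> closure N"
  proof
    assume "{s + c<..<s + d} \<subseteq> closure N"
    then have "{s + c<..<s + d} \<subseteq> interior (closure N)" by (simp add: interior_maximal)
    then have "{s + c<..<s + d} = {}" using assms(2) by (simp add: nowhere_dense_def)
    with insert.prems show False by simp
  qed
  then obtain y where y: "y \<in> {s + c<..<s + d} - closure N" by blast
  have "open ({s + c<..<s + d} - closure N)" by (simp add: open_Diff)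
  then obtain e where e: "e > 0" "ball y e \<subseteq> {s + c<..<s + d} - closure N"
    using y open_contains_ball by blast
  then have sub: "{y - e<..<y + e} \<subseteq> {s + c<..<s + d} - closure N"
    by (simp add: ball_eq_greaterThanLessThan)
  then have "{y - e<..<y + e} \<subseteq> {s + c<..<s + d}" by blast
  then have le: "s + c \<le> y - e" "y + e \<le> s + d"
    using e(1) by (auto simp: greaterThanLessThan_subseteq_greaterThanLessThan)
  obtain c' d' where cd: "y - e - s < c'" "c' < d'" "d' < y + e - s"
      "\<forall>t\<in>S. \<forall>x\<in>{c'..d'}. t + x \<notin> N"
    using insert.IH[of "y - e - s" "y + e - s"] e(1) by auto
  have "s + x \<notin> N" if "x \<in> {c'..d'}" for x
  proof -
    have "s + x \<in> {y - e<..<y + e}" using that cd by auto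
    then show ?thesis using sub closure_subset by blast
  qed
  with cd le show ?case by (intro exI[of _ c'] exI[of _ d']) auto
qed

text \<open>Enclose \<open>K\<close> in an open \<open>U\<close> that exceeds it by less than
  1/(k+1) of its measure. Translates of \<open>K\<close> that stay in \<open>U\<close> each miss
  less than this fraction of \<open>K\<close>, so all \<open>k + 1\<close> of them together cannot
  exhaust \<open>K\<close>. The intersection consists of the \<open>x\<close> with
  \<open>x + real m * a\<close> in \<open>K\<close> for every \<open>m \<le> k\<close>.\<close>

lemma compact_common_translates:
  fixes K :: "real set" and k :: nat
  assumes "compact K" "0 < measure lebesgue K"
  obtains d where "0 < d" "\<And>a. 0 \<le> a \<Longrightarrow> a < d \<Longrightarrow>
    0 < measure lebesgue (\<Inter>m\<le>k. (\<lambda>x. x - real m * a) ` K)"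
proof -
  let ?\<mu> = "measure lebesgue"
  have K: "K \<in> lmeasurable" by (simp add: assms lmeasurable_compact)
  obtain U where U: "open U" "K \<subseteq> U" "U - K \<in> lmeasurable"
      "emeasure lebesgue (U - K) < ennreal (?\<mu> K / (k + 1))"
    using sets_lebesgue_outer_open[of K "?\<mu> K / (k + 1)"] K assms(2) by auto
  have muU: "?\<mu> (U - K) < ?\<mu> K / (k + 1)"
    using U(3,4) by (metis emeasure_eq_measure2 ennreal_leI not_less)
  have Um: "U \<in> lmeasurable"
    using fmeasurable.Un[OF U(3) K] U(2) by (simp add: Un_absorb2)
  have "?\<mu> (U - K) = ?\<mu> U - ?\<mu> K" using K U(2) Um by (simp add: measurable_measure_Diff fmeasurableD)
  then have small: "?\<mu> U - ?\<mu> K < ?\<mu> K / (k + 1)" using muU by simp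
  obtain e where e: "e > 0" "(\<Union>x\<in>K. ball x e) \<subseteq> U"
    using compact_subset_open_imp_ball_epsilon_subset[OF assms(1) U(1,2)] .
  show thesis
  proof (rule that)
    \<comment> \<open>With this bound every shift \<open>real m * a\<close> is below
      \<open>e\<close>, so the translates stay in the \<open>e\<close>-neighbourhood of
      \<open>K\<close>, which lies in \<open>U\<close>.\<close>
    show "0 < e / (k + 1)" using e by simp
    fix a :: real assume a: "0 \<le> a" "a < e / (k + 1)"
    define T where "T m = (\<lambda>x. x - real m * a) ` K" for m
    have Tm: "T m \<in> lmeasurable" for m unfolding T_def by (rule measurable_translation_subtract[OF K])
    have TU: "T m \<subseteq> U" if "m \<le> k" for m
    proof -
      have "real m * a \<le> (k + 1) * a" using that a by (intro mult_right_mono) auto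
      also have "\<dots> < e" using a by (simp add: field_simps)
      finally show ?thesis using e a unfolding T_def by (force simp: dist_real_def)
    qed
    have diff: "?\<mu> (K - T m) < ?\<mu> K / (k + 1)" if "m \<le> k" for m
    proof -
      have "?\<mu> (K - T m) \<le> ?\<mu> (U - T m)"
        using U(2) K Tm Um by (intro measure_mono_fmeasurable) (auto simp: fmeasurableD fmeasurable.Diff)
      also have "\<dots> = ?\<mu> U - ?\<mu> K"
        using Tm[of m] TU[OF that] Um measure_translation_subtract[of "real m * a" K]
        by (simp add: measurable_measure_Diff fmeasurableD T_def)
      finally show ?thesis using small by simp
    qed
    have Im: "(\<Inter>m\<le>k. T m) \<in> lmeasurable"
      by (rule fmeasurable_INT[of _ 0]) (use Tm in \<open>auto simp: fmeasurableD\<close>)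
    have Dm: "(\<Union>m\<le>k. K - T m) \<in> lmeasurable"
      using K Tm by (intro fmeasurable.finite_UN) (simp_all add: fmeasurable.Diff)
    \<comment> \<open>A point of \<open>K\<close> outside the intersection lies in some
      \<open>K - T m\<close>; subadditivity then leaves positive measure for the
      intersection.\<close>
    have "?\<mu> K \<le> ?\<mu> ((\<Inter>m\<le>k. T m) \<union> (\<Union>m\<le>k. K - T m))"
      using K Im Dm by (intro measure_mono_fmeasurable fmeasurable.Un) (auto simp: fmeasurableD)
    also have "\<dots> \<le> ?\<mu> (\<Inter>m\<le>k. T m) + ?\<mu> (\<Union>m\<le>k. K - T m)"
      using Im Dm by (intro measure_Un_le) (auto simp: fmeasurableD)
    also have "?\<mu> (\<Union>m\<le>k. K - T m) \<le> (\<Sum>m\<le>k. ?\<mu> (K - T m))"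
      using K Tm by (intro measure_UNION_le) (auto simp: fmeasurableD)
    also have "\<dots> < (\<Sum>m\<le>k. ?\<mu> K / (k + 1))"
      using diff by (intro sum_strict_mono) auto
    also have "\<dots> = ?\<mu> K" by (simp add: field_simps)
    finally show "0 < ?\<mu> (\<Inter>m\<le>k. (\<lambda>x. x - real m * a) ` K)" unfolding T_def by simp
  qed
qed

text \<open>Inner regularity with error below the full measure of \<open>Z\<close> leaves a closed
  set of positive measure, and boundedness makes it compact. It starts the construction in the
  measure case.\<close>

lemma positive_measure_compact_subset:
  fixes Z :: "real set"
  assumes "Z \<in> sets lebesgue" "bounded Z" "emeasure lebesgue Z > 0"
  obtains K where "compact K" "K \<subseteq> Z" "0 < measure lebesgue K"
proof -
  have Z: "Z \<in> lmeasurable"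
    using assms(1,2) bounded_set_imp_lmeasurable by blast
  then have "0 < measure lebesgue Z"
    using assms(3) by (simp add: emeasure_eq_measure2)
  then obtain K where K: "closed K" "K \<subseteq> Z" "Z - K \<in> lmeasurable"
      "emeasure lebesgue (Z - K) < ennreal (measure lebesgue Z)"
    using sets_lebesgue_inner_closed[OF assms(1)] by blast
  have "compact K" using K assms(2) by (meson bounded_subset compact_eq_bounded_closed)
  moreover have "measure lebesgue (Z - K) < measure lebesgue Z"
    using K(3,4) by (metis emeasure_eq_measure2 ennreal_leI not_less)
  then have "0 < measure lebesgue K"
    using Z K(2) \<open>compact K\<close>
    by (simp add: measurable_measure_Diff fmeasurableD lmeasurable_compact)
  ultimately show thesis using that K(2) by blast
qed

lemma meagre_subset_sequence:
  assumes "meagre A"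
  obtains N :: "nat \<Rightarrow> 'a::topological_space set"
    where "\<And>n. nowhere_dense (N n)" "A \<subseteq> (\<Union>n. N n)"
proof -
  obtain F where F: "countable F" "\<forall>N\<in>F. nowhere_dense N" "A = \<Union>F"
    using assms unfolding meagre_def by blast
  \<comment> \<open>Inserting the empty set, itself nowhere dense, makes the family nonempty, so
    that it is the range of a sequence.\<close>
  define N where "N = from_nat_into (insert {} F)"
  have ran: "range N = insert {} F"
    unfolding N_def using F(1) by (intro range_from_nat_into) auto
  show thesis
  proof (rule that)
    have "N n \<in> insert {} F" for n using ran by blast
    then show "nowhere_dense (N n)" for n
      using F(2) by (metis insertE nowhere_dense_def closure_empty interior_empty)
    show "A \<subseteq> (\<Union>n. N n)" by (simp add: ran F(3))
  qed
qed

section \<open>The two cases and the conclusion\<close>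

lemma continuum_sumset_nonmeagre:
  fixes Z :: "real set"
  assumes "0 < k" "\<not> meagre Z" "has_baire_property Z"
  shows "\<exists>H :: real set. H \<approx> (UNIV :: real set) \<and> ksumset k H \<subseteq> Z"
proof -
  obtain U where U: "open U" "meagre ((Z - U) \<union> (U - Z))"
    using assms(3) unfolding has_baire_property_def by blast
  \<comment> \<open>For empty \<open>U\<close> the symmetric difference would be \<open>Z\<close>
    itself.\<close>
  have "U \<noteq> {}" using U(2) assms(2) by auto
  then obtain u where "u \<in> U" by blast
  then obtain r where r: "0 < r" "cball u r \<subseteq> U" using U(1) open_contains_cball by blast
  obtain N where N: "\<And>n::nat. nowhere_dense (N n)" "(Z - U) \<union> (U - Z) \<subseteq> (\<Union>n. N n)"
    using meagre_subset_sequence[OF U(2)] by metis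
  \<comment> \<open>By stage \<open>n\<close> the sets \<open>N j\<close> with \<open>j < n\<close>
    are avoided. A point covered at every stage lies in \<open>U\<close> and outside all
    \<open>N j\<close>, hence in \<open>Z\<close>.\<close>
  define P where "P n K S \<longleftrightarrow> finite S \<and> (\<exists>c d. c < d \<and> K = {c..d}) \<and>
      (\<forall>s\<in>S. \<forall>x\<in>K. s + x \<in> U \<and> (\<forall>j<n. s + x \<notin> N j))" for n :: nat and K S :: "real set"
  have "\<exists>H :: real set. H \<approx> (UNIV :: real set) \<and>
    (\<forall>y\<in>ksumset k H. \<forall>n. \<exists>K S. P n K S \<and> (\<exists>s\<in>S. \<exists>x\<in>K. y = s + x))"
  proof (rule continuum_sumset_scheme[OF assms(1)])
    show "P 0 {u - r..u + r} {0}"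
      using r unfolding P_def by (auto simp: cball_eq_atLeastAtMost intro!: exI[of _ "u - r"] exI[of _ "u + r"])
    show "compact K \<and> K \<noteq> {}" if "P n K S" for n K S using that unfolding P_def by auto
    fix n K S and e :: real assume P: "P n K S" and "0 < e"
    then obtain c d where cd: "c < d" "K = {c..d}" and fin: "finite S" unfolding P_def by blast
    obtain c' d' where c': "c < c'" "c' < d'" "d' < d" "\<forall>s\<in>S. \<forall>x\<in>{c'..d'}. s + x \<notin> N n"
      using interval_translates_avoid_nowhere_dense[OF fin N(1) cd(1)] by blast
    \<comment> \<open>All shifts go to the right by at most half the length of
      \<open>{c'..d'}\<close>, so its left half is a suitable new interval.\<close>
    define a where "a = min (e / 2) ((d' - c') / (2 * k))"
    have a: "0 < a" "a < e" "k * a \<le> (d' - c') / 2"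
      using \<open>0 < e\<close> \<open>0 < k\<close> c' by (auto simp: a_def field_simps min_def)
    have ma: "0 \<le> real m * a" "real m * a \<le> (d' - c') / 2" if "m \<le> k" for m
    proof -
      have "real m * a \<le> k * a" using that a by (intro mult_right_mono) auto
      with a show "real m * a \<le> (d' - c') / 2" by linarith
    qed (use a in auto)
    let ?K = "{c'..(c' + d') / 2}"
    have in': "x + real m * a \<in> {c'..d'}" if "m \<le> k" "x \<in> ?K" for m x
      using ma[OF that(1)] that(2) by (auto simp: field_simps)
    have inK: "x + real m * a \<in> K" if "m \<le> k" "x \<in> ?K" for m x
      using in'[OF that] cd c' by auto
    have "P (Suc n) ?K ((\<lambda>(s, m). s + real m * a) ` (S \<times> {..k}))"
      unfolding P_def
    proof (intro conjI)
      show "finite ((\<lambda>(s, m). s + real m * a) ` (S \<times> {..k}))" using fin by simp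
      show "\<exists>c d. c < d \<and> ?K = {c..d}"
        using c' by (intro exI[of _ c'] exI[of _ "(c' + d') / 2"]) simp
      have "s + real m * a + x \<in> U \<and> (\<forall>j<Suc n. s + real m * a + x \<notin> N j)"
        if "s \<in> S" "m \<le> k" "x \<in> ?K" for s m x
      proof -
        \<comment> \<open>Moving the increment from the partial sum to the point reduces the claim
          to the old \<open>s\<close> and a point of \<open>{c'..d'}\<close>, which lies in
          \<open>K\<close> and avoids \<open>N n\<close> after translation by
          \<open>s\<close>.\<close>
        have eq: "s + real m * a + x = s + (x + real m * a)" by simp
        show ?thesis
          using P inK[OF that(2,3)] in'[OF that(2,3)] c'(4) that(1)
          unfolding P_def eq by (auto simp: less_Suc_eq)
      qed
      then show "\<forall>t\<in>(\<lambda>(s, m). s + real m * a) ` (S \<times> {..k}). \<forall>x\<in>?K.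
          t + x \<in> U \<and> (\<forall>j<Suc n. t + x \<notin> N j)" by auto
    qed
    then show "\<exists>a K'. 0 < a \<and> a < e \<and> (\<forall>m\<le>k. \<forall>x\<in>K'. x + real m * a \<in> K) \<and>
        P (Suc n) K' ((\<lambda>(s, m). s + real m * a) ` (S \<times> {..k}))"
      using a inK by (intro exI[of _ a] exI[of _ ?K]) blast
  qed
  then obtain H :: "real set" where H: "H \<approx> (UNIV :: real set)"
    "\<And>y n. y \<in> ksumset k H \<Longrightarrow> \<exists>K S. P n K S \<and> (\<exists>s\<in>S. \<exists>x\<in>K. y = s + x)" by blast
  have "y \<in> Z" if "y \<in> ksumset k H" for y
  proof -
    have "y \<in> U" using H(2)[OF that, of 0] unfolding P_def by blast
    moreover have "y \<notin> N j" for j using H(2)[OF that, of "Suc j"] unfolding P_def by blast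
    ultimately show ?thesis using N(2) by blast
  qed
  with H(1) show ?thesis by blast
qed

lemma continuum_sumset_positive_measure:
  fixes Z :: "real set"
  assumes "0 < k" "Z \<in> sets lebesgue" "bounded Z" "emeasure lebesgue Z > 0"
  shows "\<exists>H :: real set. H \<approx> (UNIV :: real set) \<and> ksumset k H \<subseteq> Z"
proof -
  obtain K0 where K0: "compact K0" "K0 \<subseteq> Z" "0 < measure lebesgue K0"
    using positive_measure_compact_subset[OF assms(2-4)] .
  \<comment> \<open>Membership in \<open>Z\<close> is built into every stage, so no limit over
    \<open>n\<close> remains at the end; positive measure keeps \<open>K\<close> nonempty and allows
    the next refinement.\<close>
  define P where "P n K S \<longleftrightarrow> compact K \<and> 0 < measure lebesgue K \<and> (\<forall>s\<in>S. \<forall>x\<in>K. s + x \<in> Z)"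
    for n :: nat and K S :: "real set"
  have "\<exists>H :: real set. H \<approx> (UNIV :: real set) \<and>
    (\<forall>y\<in>ksumset k H. \<forall>n. \<exists>K S. P n K S \<and> (\<exists>s\<in>S. \<exists>x\<in>K. y = s + x))"
  proof (rule continuum_sumset_scheme[OF assms(1)])
    show "P 0 K0 {0}" using K0 by (auto simp: P_def)
    show "compact K \<and> K \<noteq> {}" if "P n K S" for n K S using that unfolding P_def by auto
    fix n K S and e :: real assume P: "P n K S" and "0 < e"
    then obtain d where d: "0 < d" "\<And>a. 0 \<le> a \<Longrightarrow> a < d \<Longrightarrow>
        0 < measure lebesgue (\<Inter>m\<le>k. (\<lambda>x. x - real m * a) ` K)"
      using compact_common_translates[of K k] unfolding P_def by blast
    define a where "a = min d e / 2"
    have a: "0 < a" "a < d" "a < e" using \<open>0 < e\<close> d(1) by (auto simp: a_def)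
    define K' where "K' = (\<Inter>m\<le>k. (\<lambda>x. x - real m * a) ` K)"
    have inK: "x + real m * a \<in> K" if "m \<le> k" "x \<in> K'" for m x
      using that unfolding K'_def by force
    have "compact K'"
      unfolding K'_def using P
      by (intro compact_Inter) (auto simp: P_def compact_translation_subtract)
    moreover have "0 < measure lebesgue K'" unfolding K'_def using a by (intro d(2)) auto
    moreover have "s + real m * a + x \<in> Z" if "s \<in> S" "m \<le> k" "x \<in> K'" for s m x
    proof -
      have "s + (x + real m * a) \<in> Z" using P inK[OF that(2,3)] that(1) unfolding P_def by blast
      then show ?thesis by (simp add: ac_simps)
    qed
    ultimately have "P (Suc n) K' ((\<lambda>(s, m). s + real m * a) ` (S \<times> {..k}))"
      unfolding P_def by auto
    then show "\<exists>a K'. 0 < a \<and> a < e \<and> (\<forall>m\<le>k. \<forall>x\<in>K'. x + real m * a \<in> K) \<and>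
        P (Suc n) K' ((\<lambda>(s, m). s + real m * a) ` (S \<times> {..k}))"
      using a inK by blast
  qed
  then obtain H :: "real set" where H: "H \<approx> (UNIV :: real set)"
    "\<And>y n. y \<in> ksumset k H \<Longrightarrow> \<exists>K S. P n K S \<and> (\<exists>s\<in>S. \<exists>x\<in>K. y = s + x)" by blast
  have "y \<in> Z" if "y \<in> ksumset k H" for y
    using H(2)[OF that] unfolding P_def by blast
  with H(1) show ?thesis by blast
qed

theorem theorem4p4:
  fixes k :: nat and Z :: "real set"
  assumes "k \<ge> 2"
    and "Z \<subseteq> {0<..<1}"
    and "(\<not> meagre Z \<and> has_baire_property Z) \<or> (Z \<in> sets lebesgue \<and> emeasure lebesgue Z > 0)"
  shows "\<exists>H :: real set. H \<approx> (UNIV :: real set) \<and> ksumset k H \<subseteq> Z"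
proof -
  have "0 < k" using assms(1) by simp
  moreover have "bounded Z" by (rule bounded_subset[OF bounded_box[of 0 1]]) (use assms(2) in simp)
  ultimately show ?thesis using assms(3) continuum_sumset_nonmeagre continuum_sumset_positive_measure by blast
qed

end
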